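(* Let $u$ be a discrete density with $u_K>0$ for all cells $K$ and let $\phi$ be a discrete potential. For every cell $K$ and every $\sigma\in\mathcal{E}_K$, the Scharfetter--Gummel flux $$\mathcal{F}_{K,\sigma}[u,\phi]=\tau_\sigma\big(B(-\mathrm{D}_{K,\sigma}\phi)u_{K,\sigma}-B(\mathrm{D}_{K,\sigma}\phi)u_K\big)$$ admits the representation $$\mathcal{F}_{K,\sigma}[u,\phi]=\tau_\sigma B(|\mathrm{D}_{K,\sigma}\phi|)\,\mathrm{D}_{K,\sigma}u+\tau_\sigma\widehat u_\sigma\,\mathrm{D}_{K,\sigma}\phi,$$ where $\widehat u_\sigma:=u_{K,\sigma}$ if $\mathrm{D}_{K,\sigma}\phi\ge0$ and $\widehat u_\sigma:=u_K$ if $\mathrm{D}_{K,\sigma}\phi<0$.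
   Context: $\mathcal{T}$ is a finite-volume mesh with cells $K$; $\mathcal{E}_K$ is the set of edges (faces) of $K$. For a cellwise quantity $v=(v_K)_{K\in\mathcal{T}}$, together with given values $v_\sigma$ on exterior edges, $\mathrm{D}_{K,\sigma}v=v_{K,\sigma}-v_K$, where $v_{K,\sigma}=v_L$ if $\sigma=K|L$ is the common edge of $K$ and $L$, and $v_{K,\sigma}=v_\sigma$ if $\sigma$ is an exterior edge. $\tau_\sigma=\mathrm{m}(\sigma)/\mathrm{d}_\sigma>0$ is the transmissibility coefficient ($\mathrm{m}(\sigma)$ the measure of $\sigma$; $\mathrm{d}_\sigma$ the distance between cell points $x_K,x_L$ if $\sigma=K|L$, or between $x_K$ and $\sigma$ if $\sigma$ is exterior). $B(s)=s/(e^s-1)$ for $s\neq0$, $B(0)=1$. *)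

theory Defs
  imports "HOL-Analysis.Analysis"
begin

definition bernoulli_fun :: "real \<Rightarrow> real" where
  "bernoulli_fun s = (if s = 0 then 1 else s / (exp s - 1))"

text \<open>
  The $(d-1)$-dimensional Lebesgue measure of a subset \<open>S\<close> of a hyperplane of a \<open>d\<close>-dimensional
  space is rendered as the \<open>d\<close>-dimensional Lebesgue measure of the cylinder of height 1 over \<open>S\<close>.
  The choice of the unit normal does not matter: if \<open>S\<close> spans the hyperplane, the normal is
  unique up to sign (and the two cylinders are translates of each other); otherwise the
  cylinder is contained in a hyperplane and has measure 0. For \<open>d = 1\<close> a point has measure 1.
\<close>

definition unit_normal :: "'a::euclidean_space set \<Rightarrow> 'a" where
  "unit_normal S = (SOME n. norm n = 1 \<and> (\<forall>x\<in>S. \<forall>y\<in>S. n \<bullet> (x - y) = 0))"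

definition face_measure :: "'a::euclidean_space set \<Rightarrow> real" where
  "face_measure S =
     measure lebesgue {x + t *\<^sub>R unit_normal S | x t. x \<in> S \<and> 0 \<le> t \<and> t \<le> 1}"

record 'a mesh =
  region :: "'a set"
  cells :: "'a set set"
  edges :: "'a set \<Rightarrow> 'a set set"
  center :: "'a set \<Rightarrow> 'a"

definition all_edges :: "'a mesh \<Rightarrow> 'a set set" where
  "all_edges M = (\<Union>K\<in>cells M. edges M K)"

definition exterior_edges :: "'a::euclidean_space mesh \<Rightarrow> 'a set set" where
  "exterior_edges M = {\<sigma> \<in> all_edges M. \<sigma> \<subseteq> frontier (region M)}"

text \<open>\<open>interface M K L \<sigma>\<close> stands for $\sigma = K|L$.\<close>

definition interface :: "'a mesh \<Rightarrow> 'a set \<Rightarrow> 'a set \<Rightarrow> 'a set \<Rightarrow> bool" where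
  "interface M K L \<sigma> \<longleftrightarrow>
     K \<in> cells M \<and> L \<in> cells M \<and> K \<noteq> L \<and> \<sigma> \<in> edges M K \<and> \<sigma> \<in> edges M L"

text \<open>
  The definite descriptions below are meaningful on every mesh in the sense of the locale
  \<open>fv_mesh\<close>; see the lemmas \<open>edge_dist_exterior\<close>, \<open>edge_dist_interior\<close> and \<open>edge_val_interior\<close>.
\<close>

definition edge_dist :: "'a::euclidean_space mesh \<Rightarrow> 'a set \<Rightarrow> real" where
  "edge_dist M \<sigma> =
     (if \<sigma> \<in> exterior_edges M
      then (THE d. \<exists>K\<in>cells M. \<sigma> \<in> edges M K \<and> d = infdist (center M K) \<sigma>)
      else (THE d. \<exists>K L. interface M K L \<sigma> \<and> d = dist (center M K) (center M L)))"

definition transmissibility :: "'a::euclidean_space mesh \<Rightarrow> 'a set \<Rightarrow> real" where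
  "transmissibility M \<sigma> = face_measure \<sigma> / edge_dist M \<sigma>"

text \<open>
  Only the structural properties of a finite-volume mesh are required. Convexity of the cells,
  orthogonality of $x_L - x_K$ to $K|L$, and the position of $x_K$ relative to \<open>K\<close> are left
  free, so admissible meshes are included. Edges may be relatively open or closed.
\<close>

locale fv_mesh =
  fixes M :: "'a::euclidean_space mesh"
  assumes open_region: "open (region M)"
    and bounded_region: "bounded (region M)"
    and finite_cells: "finite (cells M)"
    and open_cell: "K \<in> cells M \<Longrightarrow> open K"
    and nonempty_cell: "K \<in> cells M \<Longrightarrow> K \<noteq> {}"
    and cell_subset: "K \<in> cells M \<Longrightarrow> K \<subseteq> region M"
    and disjoint_cells: "K \<in> cells M \<Longrightarrow> L \<in> cells M \<Longrightarrow> K \<noteq> L \<Longrightarrow> K \<inter> L = {}"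
    and cells_cover: "closure (\<Union>(cells M)) = closure (region M)"
    and finite_edges: "K \<in> cells M \<Longrightarrow> finite (edges M K)"
    and frontier_cell: "K \<in> cells M \<Longrightarrow> frontier K = (\<Union>\<sigma>\<in>edges M K. closure \<sigma>)"
    and flat_edge: "\<sigma> \<in> all_edges M \<Longrightarrow> \<exists>n c. n \<noteq> 0 \<and> \<sigma> \<subseteq> {x. n \<bullet> x = c}"
    and face_measure_pos: "\<sigma> \<in> all_edges M \<Longrightarrow> face_measure \<sigma> > 0"
    and edges_overlap: "\<sigma> \<in> all_edges M \<Longrightarrow> \<sigma>' \<in> all_edges M \<Longrightarrow> \<sigma> \<noteq> \<sigma>'
           \<Longrightarrow> face_measure (\<sigma> \<inter> \<sigma>') = 0"
    and exterior_edge: "\<sigma> \<in> exterior_edges M \<Longrightarrow> \<not> interface M K L \<sigma>"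
    and interior_edge: "K \<in> cells M \<Longrightarrow> \<sigma> \<in> edges M K \<Longrightarrow> \<sigma> \<notin> exterior_edges M
           \<Longrightarrow> \<exists>!L. interface M K L \<sigma>"
    and edge_dist_pos: "\<sigma> \<in> all_edges M \<Longrightarrow> edge_dist M \<sigma> > 0"

record 'a discrete_fun =
  cell_val :: "'a set \<Rightarrow> real"
  bdry_val :: "'a set \<Rightarrow> real"

definition edge_val :: "'a::euclidean_space mesh \<Rightarrow> 'a discrete_fun \<Rightarrow> 'a set \<Rightarrow> 'a set \<Rightarrow> real" where
  "edge_val M v K \<sigma> =
     (if \<sigma> \<in> exterior_edges M then bdry_val v \<sigma> else cell_val v (THE L. interface M K L \<sigma>))"

definition edge_diff :: "'a::euclidean_space mesh \<Rightarrow> 'a discrete_fun \<Rightarrow> 'a set \<Rightarrow> 'a set \<Rightarrow> real" where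
  "edge_diff M v K \<sigma> = edge_val M v K \<sigma> - cell_val v K"

definition sg_flux ::
  "'a::euclidean_space mesh \<Rightarrow> 'a discrete_fun \<Rightarrow> 'a discrete_fun \<Rightarrow> 'a set \<Rightarrow> 'a set \<Rightarrow> real" where
  "sg_flux M u \<phi> K \<sigma> = transmissibility M \<sigma> *
     (bernoulli_fun (- edge_diff M \<phi> K \<sigma>) * edge_val M u K \<sigma>
      - bernoulli_fun (edge_diff M \<phi> K \<sigma>) * cell_val u K)"

definition upwind_val ::
  "'a::euclidean_space mesh \<Rightarrow> 'a discrete_fun \<Rightarrow> 'a discrete_fun \<Rightarrow> 'a set \<Rightarrow> 'a set \<Rightarrow> real" where
  "upwind_val M u \<phi> K \<sigma> = (if edge_diff M \<phi> K \<sigma> \<ge> 0 then edge_val M u K \<sigma> else cell_val u K)"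

context fv_mesh
begin

lemma edge_dist_exterior:
  assumes "K \<in> cells M" "\<sigma> \<in> edges M K" "\<sigma> \<in> exterior_edges M"
  shows "edge_dist M \<sigma> = infdist (center M K) \<sigma>"
proof -
  have unique: "K' = K" if "K' \<in> cells M" "\<sigma> \<in> edges M K'" for K'
    using exterior_edge[OF assms(3), of K' K] that assms(1,2) unfolding interface_def by metis
  have "(THE d. \<exists>K\<in>cells M. \<sigma> \<in> edges M K \<and> d = infdist (center M K) \<sigma>)
        = infdist (center M K) \<sigma>"
  proof (rule the_equality)
    show "\<exists>K'\<in>cells M. \<sigma> \<in> edges M K' \<and> infdist (center M K) \<sigma> = infdist (center M K') \<sigma>"
      using assms(1,2) by metis
    show "d = infdist (center M K) \<sigma>"
      if "\<exists>K\<in>cells M. \<sigma> \<in> edges M K \<and> d = infdist (center M K) \<sigma>" for d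
      using that unique by metis
  qed
  then show ?thesis
    unfolding edge_dist_def using assms(3) by simp
qed

lemma interior_not_exterior: "interface M K L \<sigma> \<Longrightarrow> \<sigma> \<notin> exterior_edges M"
  using exterior_edge by metis

lemma interface_unique:
  assumes "interface M K L \<sigma>" "interface M K L' \<sigma>"
  shows "L' = L"
proof -
  have "K \<in> cells M" "\<sigma> \<in> edges M K"
    using assms(1) unfolding interface_def by simp_all
  from interior_edge[OF this interior_not_exterior[OF assms(1)]] show ?thesis
    using assms by metis
qed

lemma edge_dist_interior:
  assumes "interface M K L \<sigma>"
  shows "edge_dist M \<sigma> = dist (center M K) (center M L)"
proof -
  have sym: "interface M L K \<sigma>"
    using assms unfolding interface_def by metis
  have pair: "(K' = K \<and> L' = L) \<or> (K' = L \<and> L' = K)" if that: "interface M K' L' \<sigma>" for K' L'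
  proof (cases "K' = K")
    case True
    then show ?thesis using interface_unique[OF assms] that by metis
  next
    case False
    then have "interface M K K' \<sigma>"
      using that assms unfolding interface_def by metis
    then have "K' = L" using interface_unique[OF assms] by metis
    then show ?thesis using interface_unique[OF sym] that by metis
  qed
  have "(THE d. \<exists>K L. interface M K L \<sigma> \<and> d = dist (center M K) (center M L))
        = dist (center M K) (center M L)"
  proof (rule the_equality)
    show "\<exists>K' L'. interface M K' L' \<sigma>
            \<and> dist (center M K) (center M L) = dist (center M K') (center M L')"
      using assms by metis
    show "d = dist (center M K) (center M L)"
      if "\<exists>K L. interface M K L \<sigma> \<and> d = dist (center M K) (center M L)" for d
      using that pair by (metis dist_commute)
  qed
  then show ?thesis
    unfolding edge_dist_def using interior_not_exterior[OF assms] by simp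
qed

lemma edge_val_interior:
  assumes "interface M K L \<sigma>"
  shows "edge_val M v K \<sigma> = cell_val v L"
proof -
  have "(THE L. interface M K L \<sigma>) = L"
    using assms interface_unique[OF assms] by (rule the_equality)
  then show ?thesis
    unfolding edge_val_def using interior_not_exterior[OF assms] by simp
qed

lemma transmissibility_pos: "\<sigma> \<in> all_edges M \<Longrightarrow> transmissibility M \<sigma> > 0"
  unfolding transmissibility_def by (intro divide_pos_pos face_measure_pos edge_dist_pos)

end

end

theory Submission
  imports Defs
begin

text \<open>Everything rests on \<open>B(-s) = B(s) + s\<close>. With D and Du the differences of
  \<phi> and u, it rewrites the bracket of the flux both as
  \<open>B(D) Du + D u_(K,\<sigma>)\<close> and as \<open>B(-D) Du + D u_K\<close>; the sign of D
  selects the form in which B is taken at |D|.\<close>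

lemma bernoulli_fun_minus: "bernoulli_fun (- s) = bernoulli_fun s + s"
proof (cases "s = 0")
  case False
  \<comment> \<open>Denominators to clear in
    \<open>-s/(exp(-s) - 1) = s exp s/(exp s - 1) = s + s/(exp s - 1)\<close>.\<close>
  then have "exp s - 1 \<noteq> 0" "1 - exp s \<noteq> 0" by simp_all
  then show ?thesis
    using False unfolding bernoulli_fun_def by (simp add: exp_minus field_simps)
qed simp

theorem lemma4:
  fixes M :: "'a::euclidean_space mesh"
    and u \<phi> :: "'a discrete_fun"
    and K \<sigma> :: "'a set"
  assumes "fv_mesh M"
    and "\<forall>L\<in>cells M. cell_val u L > 0"
    and "K \<in> cells M"
    and "\<sigma> \<in> edges M K"
  shows "sg_flux M u \<phi> K \<sigma> =
           transmissibility M \<sigma> * bernoulli_fun \<bar>edge_diff M \<phi> K \<sigma>\<bar> * edge_diff M u K \<sigma>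
           + transmissibility M \<sigma> * upwind_val M u \<phi> K \<sigma> * edge_diff M \<phi> K \<sigma>"
proof (cases "edge_diff M \<phi> K \<sigma> \<ge> 0")
  case True
  then show ?thesis
    \<comment> \<open>Only the difference of \<open>u\<close> is unfolded; that of \<phi> stays an
      atom, leaving a polynomial identity.\<close>
    by (simp add: sg_flux_def upwind_val_def edge_diff_def [of M u] bernoulli_fun_minus algebra_simps)
next
  case False
  \<comment> \<open>Here |D| = -D.\<close>
  then have "bernoulli_fun \<bar>edge_diff M \<phi> K \<sigma>\<bar> = bernoulli_fun (edge_diff M \<phi> K \<sigma>) + edge_diff M \<phi> K \<sigma>"
    by (simp add: bernoulli_fun_minus)
  with False show ?thesis
    by (simp add: sg_flux_def upwind_val_def edge_diff_def [of M u] bernoulli_fun_minus algebra_simps)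
qed

end
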